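(* Let $n\ge 1$ be an integer, let $\lambda\in(0,1)$ and let $p\ge 1$ be a real number. Let $K,L\subset\mathbb{R}^n$ be bounded sets with $\mathrm{G}_n(K)\,\mathrm{G}_n(L)>0$. Then $$\mathrm{G}_n\bigl((1-\lambda)\cdot K+_p\lambda\cdot L+(-1,1)^n\bigr)^{p/n}\ \geq\ (1-\lambda)\,\mathrm{G}_n(K)^{p/n}+\lambda\,\mathrm{G}_n(L)^{p/n}.$$ The inequality is sharp: for every such $n$, $\lambda$, $p$ there exist bounded sets $K,L\subset\mathbb{R}^n$ with $\mathrm{G}_n(K)\,\mathrm{G}_n(L)>0$ for which equality holds.
   Context: For $M\subset\mathbb{R}^n$, $\mathrm{G}_n(M)=|M\cap\mathbb{Z}^n|$ is the lattice point enumerator (number of integer points in $M$). The symbol $+$ between sets is Minkowski addition, $A+B=\{a+b: a\in A,\ b\in B\}$, and $rA=\{ra:a\in A\}$ for $r\ge 0$. For real $p\ge 1$ let $q\in(1,\infty]$ be its Hölder conjugate, $1/p+1/q=1$. For arbitrary $A,B\subset\mathbb{R}^n$ the $p$-sum is $$A+_pB=\bigl\{(1-\mu)^{1/q}x+\mu^{1/q}y:\ x\in A,\ y\in B,\ 0\le\mu\le1\bigr\},$$ where for $p=1$ (so $q=\infty$) the coefficients $(1-\mu)^{1/q}$ and $\mu^{1/q}$ are understood to be $1$ for all $\mu\in[0,1]$, so that $A+_1B=A+B$. The $p$-scalar multiplication is $r\cdot A=r^{1/p}A$ for $r\ge0$ (the dependence on $p$ is suppressed), and $r\cdot A+_p s\cdot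 B$ means $(r\cdot A)+_p(s\cdot B)$. The expression $(1-\lambda)\cdot K+_p\lambda\cdot L+(-1,1)^n$ means the Minkowski sum of the set $(1-\lambda)\cdot K+_p\lambda\cdot L$ with the open cube $(-1,1)^n$. *)

theory Defs
  imports "HOL-Analysis.Analysis" "HOL-Library.Set_Algebras"
begin

text \<open>Minkowski addition of sets is the operation \<open>+\<close> on sets from
  \<open>HOL-Library.Set_Algebras\<close>.\<close>

definition int_lattice :: "(real ^ 'n) set" where
  "int_lattice = {x. \<forall>i. x $ i \<in> \<int>}"

text \<open>For unbounded \<open>M\<close> the intersection may be infinite, and then \<open>card\<close> returns the
  junk value 0; for bounded \<open>M\<close> it is finite.\<close>

definition lattice_points :: "(real ^ 'n) set \<Rightarrow> nat" where
  "lattice_points M = card (M \<inter> int_lattice)"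

text \<open>The value \<open>q\<close> with \<open>1/p + 1/q = 1\<close> for \<open>p > 1\<close>; the case \<open>p = 1\<close>, \<open>q = \<infinity>\<close> is treated
  separately in \<open>p_coeff\<close>.\<close>

definition hoelder_conj :: "real \<Rightarrow> real" where
  "hoelder_conj p = p / (p - 1)"

text \<open>The coefficient \<open>t\<close> to the power \<open>1/q\<close>. For \<open>p = 1\<close> it is 1 for every \<open>t\<close>, including
  \<open>t = 0\<close>, where \<open>0 powr 0\<close> would give 0.\<close>

definition p_coeff :: "real \<Rightarrow> real \<Rightarrow> real" where
  "p_coeff p t = (if p = 1 then 1 else t powr (1 / hoelder_conj p))"

definition p_sum :: "real \<Rightarrow> (real ^ 'n) set \<Rightarrow> (real ^ 'n) set \<Rightarrow> (real ^ 'n) set" where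
  "p_sum p A B =
     {p_coeff p (1 - \<mu>) *\<^sub>R x + p_coeff p \<mu> *\<^sub>R y | x y \<mu>. x \<in> A \<and> y \<in> B \<and> 0 \<le> \<mu> \<and> \<mu> \<le> 1}"

definition p_scale :: "real \<Rightarrow> real \<Rightarrow> (real ^ 'n) set \<Rightarrow> (real ^ 'n) set" where
  "p_scale p r A = (\<lambda>x. (r powr (1 / p)) *\<^sub>R x) ` A"

definition open_cube :: "(real ^ 'n) set" where
  "open_cube = {x. \<forall>i. -1 < x $ i \<and> x $ i < 1}"

end

theory Submission
  imports Defs "HOL-Probability.Distribution_Functions"
begin

text \<open>Write \<open>G\<close> for the number of lattice points. Fixing one parameter \<open>\<mu>\<close>, the \<open>p\<close>-sum contains the
  ordinary linear combination \<open>a K + b L\<close> with \<open>a = (1 - \<mu>)\<^sup>1\<^sup>/\<^sup>q (1 - \<lambda>)\<^sup>1\<^sup>/\<^sup>p\<close> and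
  \<open>b = \<mu>\<^sup>1\<^sup>/\<^sup>q \<lambda>\<^sup>1\<^sup>/\<^sup>p\<close>. Young's inequality gives \<open>a + b \<le> 1\<close>, and for a suitable \<open>\<mu>\<close> Hoelder's
  inequality is an equality: \<open>(a u + b v)\<^sup>p = (1 - \<lambda>) u\<^sup>p + \<lambda> v\<^sup>p\<close> for the numbers
  \<open>u = G(K)\<^sup>1\<^sup>/\<^sup>n\<close> and \<open>v = G(L)\<^sup>1\<^sup>/\<^sup>n\<close> (lemma \<open>optimal_p_coefficients\<close>). So the theorem follows
  from the linear statement \<open>discrete_brunn_minkowski\<close>: if \<open>a, b > 0\<close> and \<open>a + b \<le> 1\<close>, then
  \<open>G(a K + b L + (-1,1)\<^sup>n)\<^sup>1\<^sup>/\<^sup>n \<ge> a G(K)\<^sup>1\<^sup>/\<^sup>n + b G(L)\<^sup>1\<^sup>/\<^sup>n\<close>.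

  The linear statement reduces to volumes. Replace \<open>K\<close> and \<open>L\<close> by their lattice points. Attaching to
  each of them a unit cube gives bodies of volume \<open>G(K)\<close> and \<open>G(L)\<close>, and the sum of the
  dilates of these bodies by \<open>a\<close> and \<open>b\<close> lies in \<open>a K + b L + (0,1)\<^sup>n\<close> because \<open>a + b \<le> 1\<close>. The
  coordinatewise floor of a point of this set lies in \<open>a K + b L + (-1,1)\<^sup>n\<close>, so the volume is at
  most the number of lattice points there (\<open>measure_le_lattice_points\<close>).

  It remains to bound the volume of the sum from below, which is the Brunn-Minkowski inequality for
  finite disjoint unions of boxes (\<open>brunn_minkowski_box_families\<close>). It is proved by the
  cutting argument of Hadwiger and Ohmann: for two boxes it is the inequality between the arithmetic and
  geometric means, and otherwise a hyperplane that separates two boxes of one family and a parallel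
  hyperplane that cuts the other union in the same ratio reduce the claim to pairs with fewer boxes.

  Equality holds for \<open>K = L = {0}\<close>.\<close>

section \<open>The inequality for two boxes\<close>

lemma root_prod:
  assumes "n > 0"
  shows "root n (\<Prod>i\<in>I. f i) = (\<Prod>i\<in>I. root n (f i))"
  using assms by (induction I rule: infinite_finite_induct) (auto simp: real_root_mult)

text \<open>Superadditivity of the geometric mean: divide by the right-hand side. Each of the two resulting
  quotients is the geometric mean of \<open>x i / (x i + y i)\<close> or \<open>y i / (x i + y i)\<close>, at most the
  arithmetic mean, and these two arithmetic means add up to 1.\<close>

lemma root_prod_superadditive:
  fixes x y :: "'i \<Rightarrow> real"
  assumes I: "finite I" "I \<noteq> {}" and pos: "\<And>i. i \<in> I \<Longrightarrow> 0 < x i" "\<And>i. i \<in> I \<Longrightarrow> 0 < y i"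
  shows "root (card I) (\<Prod>i\<in>I. x i) + root (card I) (\<Prod>i\<in>I. y i)
           \<le> root (card I) (\<Prod>i\<in>I. x i + y i)"
proof -
  let ?n = "card I" and ?P = "\<Prod>i\<in>I. x i + y i"
  have n: "?n > 0" using I by (simp add: card_gt_0_iff)
  have s: "x i + y i > 0" if "i \<in> I" for i using pos[OF that] by simp
  have split: "root ?n (\<Prod>i\<in>I. z i) \<le> (\<Sum>i\<in>I. z i / (x i + y i) / ?n) * root ?n ?P"
    if z: "\<And>i. i \<in> I \<Longrightarrow> 0 < z i" for z
  proof -
    have "(\<Prod>i\<in>I. z i) = (\<Prod>i\<in>I. z i / (x i + y i)) * ?P"
      unfolding prod.distrib[symmetric] using s by (intro prod.cong) force+
    then have factor: "root ?n (\<Prod>i\<in>I. z i) = root ?n (\<Prod>i\<in>I. z i / (x i + y i)) * root ?n ?P"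
      by (simp add: real_root_mult)
    have "root ?n (\<Prod>i\<in>I. z i / (x i + y i)) = (\<Prod>i\<in>I. z i / (x i + y i)) powr (1 / ?n)"
      using n s z by (intro root_powr_inverse prod_nonneg) (auto intro: less_imp_le)
    also have "\<dots> \<le> (\<Sum>i\<in>I. z i / (x i + y i) / ?n)"
      using z s by (intro arith_geom_mean I) (auto intro: less_imp_le)
    finally have mean: "root ?n (\<Prod>i\<in>I. z i / (x i + y i)) \<le> (\<Sum>i\<in>I. z i / (x i + y i) / ?n)" .
    have "0 \<le> root ?n ?P"
      using n s by (auto intro!: prod_nonneg intro: less_imp_le)
    with mean show ?thesis
      unfolding factor by (rule mult_right_mono)
  qed
  have "(\<Sum>i\<in>I. x i / (x i + y i) / ?n) + (\<Sum>i\<in>I. y i / (x i + y i) / ?n) = (\<Sum>i\<in>I. 1 / ?n)"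
    unfolding sum.distrib[symmetric] add_divide_distrib[symmetric]
    by (intro sum.cong) (use s in force)+
  also have "\<dots> = 1" using n by simp
  finally show ?thesis
    using add_mono[OF split[of x, OF pos(1)] split[of y, OF pos(2)]]
    by (simp add: distrib_right[symmetric])
qed

text \<open>A point of the large box is decomposed by using, in each coordinate, the same relative position
  in all three boxes.\<close>

lemma box_sum_superset:
  fixes a b c d :: "'a::euclidean_space"
  assumes "box a b \<noteq> {}" "box c d \<noteq> {}"
  shows "box (a + c) (b + d) \<subseteq> box a b + box c d"
proof
  fix x assume x: "x \<in> box (a + c) (b + d)"
  have ab: "a \<bullet> i < b \<bullet> i" and cd: "c \<bullet> i < d \<bullet> i" if "i \<in> Basis" for i
    using assms that by (auto simp: box_ne_empty)
  define r where "r i = (x \<bullet> i - (a + c) \<bullet> i) / ((b + d) \<bullet> i - (a + c) \<bullet> i)" for i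
  have r: "0 < r i" "r i < 1" if "i \<in> Basis" for i
    using x ab[OF that] cd[OF that] that
    by (auto simp: r_def mem_box inner_add_left)
  define y where "y = (\<Sum>i\<in>Basis. (a \<bullet> i + r i * (b \<bullet> i - a \<bullet> i)) *\<^sub>R i)"
  define z where "z = (\<Sum>i\<in>Basis. (c \<bullet> i + r i * (d \<bullet> i - c \<bullet> i)) *\<^sub>R i)"
  have between: "u < u + t * (v - u)" "u + t * (v - u) < v" if "0 < t" "t < 1" "u < v" for t u v :: real
  proof -
    have "t * (v - u) < 1 * (v - u)" using that by (intro mult_strict_right_mono) auto
    then show "u + t * (v - u) < v" by simp
  qed (use that in auto)
  have "y \<in> box a b" "z \<in> box c d"
    using between r ab cd by (auto simp: y_def z_def mem_box inner_sum_left_Basis)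
  moreover have "x = y + z"
  proof (rule euclidean_eqI)
    fix i :: 'a assume i: "i \<in> Basis"
    have "r i * ((b + d) \<bullet> i - (a + c) \<bullet> i) = x \<bullet> i - (a + c) \<bullet> i"
      using ab[OF i] cd[OF i] by (simp add: r_def inner_add_left)
    moreover have "y \<bullet> i = a \<bullet> i + r i * (b \<bullet> i - a \<bullet> i)" "z \<bullet> i = c \<bullet> i + r i * (d \<bullet> i - c \<bullet> i)"
      using i by (simp_all add: y_def z_def)
    ultimately show "x \<bullet> i = (y + z) \<bullet> i"
      by (simp add: inner_add_left algebra_simps)
  qed
  ultimately show "x \<in> box a b + box c d" by blast
qed

lemma open_set_plus:
  fixes A B :: "'a::real_normed_vector set"
  assumes "open A \<or> open B"
  shows "open (A + B)"
proof -
  have "A + B = (\<Union>x\<in>A. \<Union>y\<in>B. {x + y})"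
    by (auto simp: set_plus_def)
  then show ?thesis using open_sums[OF assms] by simp
qed

lemma bounded_set_plus:
  fixes A B :: "'a::real_normed_vector set"
  assumes "bounded A" "bounded B"
  shows "bounded (A + B)"
  using bounded_plus[OF assms] by (simp add: set_plus_image)

lemma brunn_minkowski_box:
  fixes a b c d :: "'a::euclidean_space"
  assumes ne: "box a b \<noteq> {}" "box c d \<noteq> {}"
  shows "root DIM('a) (measure lebesgue (box a b)) + root DIM('a) (measure lebesgue (box c d))
           \<le> root DIM('a) (measure lebesgue (box a b + box c d))"
proof -
  have ab: "a \<bullet> i < b \<bullet> i" and cd: "c \<bullet> i < d \<bullet> i" if "i \<in> Basis" for i
    using assms that by (auto simp: box_ne_empty)
  have "root DIM('a) (\<Prod>i\<in>Basis. (b - a) \<bullet> i) + root DIM('a) (\<Prod>i\<in>Basis. (d - c) \<bullet> i)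
          \<le> root DIM('a) (\<Prod>i\<in>Basis. (b - a) \<bullet> i + (d - c) \<bullet> i)"
    using ab cd by (intro root_prod_superadditive) (auto simp: inner_diff_left)
  also have "(\<Prod>i\<in>Basis. (b - a) \<bullet> i + (d - c) \<bullet> i) = measure lebesgue (box (a + c) (b + d))"
    using ab cd by (subst measure_completion)
      (auto simp: measure_lborel_box_eq inner_add_left inner_diff_left algebra_simps add_mono less_imp_le
         intro!: prod.cong)
  also have "root DIM('a) \<dots> \<le> root DIM('a) (measure lebesgue (box a b + box c d))"
    using ne by (intro real_root_le_mono measure_mono_fmeasurable box_sum_superset lmeasurable_open
        open_set_plus bounded_set_plus) auto
  finally show ?thesis
    using ab cd by (simp add: less_imp_le inner_diff_left)
qed

section \<open>Cutting by a coordinate hyperplane\<close>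

lemma box_Int_halfspace_lt:
  fixes a b :: "'a::euclidean_space"
  assumes "k \<in> Basis"
  shows "box a b \<inter> {x. x \<bullet> k < t}
           = box a (\<Sum>i\<in>Basis. (if i = k then min (b \<bullet> k) t else b \<bullet> i) *\<^sub>R i)"
  using assms by (fastforce simp: mem_box set_eq_iff split: if_splits)

lemma box_Int_halfspace_gt:
  fixes a b :: "'a::euclidean_space"
  assumes "k \<in> Basis"
  shows "box a b \<inter> {x. t < x \<bullet> k}
           = box (\<Sum>i\<in>Basis. (if i = k then max (a \<bullet> k) t else a \<bullet> i) *\<^sub>R i) b"
  using assms by (fastforce simp: mem_box set_eq_iff split: if_splits)

text \<open>Boxes are open, so that cutting one by a coordinate hyperplane gives two open boxes and loses only a
  null set, and so that nonempty unions have positive volume. Both requirements of nonemptiness serve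
  the induction: the base case is a pair of single boxes, and distinct members are separated by a
  hyperplane.\<close>

definition box_family :: "'a::euclidean_space set set \<Rightarrow> bool" where
  "box_family F \<longleftrightarrow> finite F \<and> F \<noteq> {} \<and> disjoint F \<and> (\<forall>S\<in>F. S \<noteq> {} \<and> (\<exists>a b. S = box a b))"

text \<open>The empty set is removed because a box that misses \<open>H\<close> must no longer be counted: this makes the
  number of boxes decrease.\<close>

definition trace_family :: "'a set set \<Rightarrow> 'a set \<Rightarrow> 'a set set" where
  "trace_family F H = (\<lambda>S. S \<inter> H) ` F - {{}}"

lemma Union_trace_family: "\<Union>(trace_family F H) = \<Union>F \<inter> H"
  by (auto simp: trace_family_def)

lemma card_trace_family_le: "finite F \<Longrightarrow> card (trace_family F H) \<le> card F"
  unfolding trace_family_def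
  by (meson card_Diff1_le card_image_le finite_imageI order_trans)

lemma card_trace_family_less:
  assumes "finite F" "S \<in> F" "S \<inter> H = {}"
  shows "card (trace_family F H) < card F"
proof -
  have "trace_family F H \<subseteq> (\<lambda>S. S \<inter> H) ` (F - {S})"
    using assms by (auto simp: trace_family_def)
  then have "card (trace_family F H) \<le> card (F - {S})"
    using assms by (meson card_image_le card_mono finite_Diff finite_imageI order_trans)
  then show ?thesis using assms by (meson card_Diff1_less order_le_less_trans)
qed

lemma box_family_trace:
  fixes F :: "'a::euclidean_space set set"
  assumes F: "box_family F" and k: "k \<in> Basis"
    and H: "H = {x. x \<bullet> k < t} \<or> H = {x. t < x \<bullet> k}" and ne: "\<Union>F \<inter> H \<noteq> {}"
  shows "box_family (trace_family F H)"
  unfolding box_family_def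
proof (intro conjI ballI)
  show "finite (trace_family F H)"
    using F by (auto simp: box_family_def trace_family_def)
  show "trace_family F H \<noteq> {}"
    using ne Union_trace_family[of F H] by auto
  show "disjoint (trace_family F H)"
    using F unfolding box_family_def trace_family_def disjoint_def by blast
  fix S assume S: "S \<in> trace_family F H"
  then show "S \<noteq> {}" by (auto simp: trace_family_def)
  obtain T where "T \<in> F" "S = T \<inter> H" using S by (auto simp: trace_family_def)
  moreover from this obtain a b where "T = box a b" using F unfolding box_family_def by blast
  ultimately show "\<exists>a b. S = box a b"
    using H box_Int_halfspace_lt[OF k, of a b t] box_Int_halfspace_gt[OF k, of a b t] by blast
qed

lemma box_family_Union:
  assumes "box_family F"
  shows "open (\<Union>F)" "bounded (\<Union>F)" "\<Union>F \<in> lmeasurable" "\<Union>F \<noteq> {}"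
proof -
  show "open (\<Union>F)" "bounded (\<Union>F)" "\<Union>F \<noteq> {}"
    using assms unfolding box_family_def by (fastforce intro!: open_Union bounded_Union)+
  then show "\<Union>F \<in> lmeasurable" by (simp add: lmeasurable_open)
qed

lemma measure_open_pos:
  fixes U :: "'a::euclidean_space set"
  assumes "open U" "bounded U" "U \<noteq> {}"
  shows "0 < measure lebesgue U"
proof -
  have "\<not> negligible U" using assms open_not_negligible by blast
  then show ?thesis
    using assms negligible_iff_measure0 lmeasurable_open zero_less_measure_iff by metis
qed

lemma box_family_separate:
  fixes F :: "'a::euclidean_space set set"
  assumes F: "box_family F" and ST: "S \<in> F" "T \<in> F" "S \<noteq> T"
  obtains k t S' T' where "k \<in> Basis" "S' \<in> F" "T' \<in> F"
    "S' \<subseteq> {x. x \<bullet> k < t}" "T' \<subseteq> {x. t < x \<bullet> k}"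
proof -
  obtain a b c d where eq: "S = box a b" "T = box c d" using F ST unfolding box_family_def by metis
  have ne: "box a b \<noteq> {}" "box c d \<noteq> {}" using F ST eq by (auto simp: box_family_def)
  have "box a b \<inter> box c d = {}" using F ST eq by (auto simp: box_family_def disjoint_def)
  then obtain k where k: "k \<in> Basis" "b \<bullet> k \<le> c \<bullet> k \<or> d \<bullet> k \<le> a \<bullet> k"
    using ne unfolding disjoint_interval(4) box_ne_empty(2) by (meson not_le)
  show thesis
  proof (cases "b \<bullet> k \<le> c \<bullet> k")
    case True
    then show thesis using that[of k S T "b \<bullet> k"] k ST eq by (force simp: mem_box)
  next
    case False
    then show thesis using that[of k T S "d \<bullet> k"] k ST eq by (force simp: mem_box)
  qed
qed

lemma measure_split_hyperplane:
  fixes U :: "'a::euclidean_space set"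
  assumes U: "open U" "bounded U" and k: "k \<in> Basis"
  shows "measure lebesgue U
    = measure lebesgue (U \<inter> {x. x \<bullet> k < t}) + measure lebesgue (U \<inter> {x. t < x \<bullet> k})"
proof -
  let ?L = "U \<inter> {x. x \<bullet> k < t}" and ?R = "U \<inter> {x. t < x \<bullet> k}"
  have m: "?L \<in> lmeasurable" "?R \<in> lmeasurable"
    using U by (auto intro!: lmeasurable_open bounded_Int open_halfspace_component_lt
        open_halfspace_component_gt)
  have "measure lebesgue (?L \<union> ?R) = measure lebesgue U"
  proof (rule measure_negligible_symdiff)
    show "U \<in> lmeasurable" using U by (rule lmeasurable_open[rotated])
    show "negligible (sym_diff U (?L \<union> ?R))" 
      by (rule negligible_subset[OF negligible_standard_hyperplane[OF k, of t]]) auto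
  qed
  moreover have "measure lebesgue (?L \<union> ?R) = measure lebesgue ?L + measure lebesgue ?R"
    using m by (intro measure_Un_AE) auto
  ultimately show ?thesis by simp
qed

text \<open>The volume of the part of \<open>U\<close> on the lower side of the hyperplane, as a function of its height, is
  the distribution function of the \<open>k\<close>-th coordinate on \<open>U\<close>. It is continuous since
  hyperplanes are null sets, and it runs from 0 to the volume of \<open>U\<close>, so the intermediate value
  theorem applies.\<close>

lemma exists_hyperplane_of_ratio:
  fixes U :: "'a::euclidean_space set"
  assumes U: "open U" "bounded U" and k: "k \<in> Basis" and r: "0 < r" "r < 1"
  shows "\<exists>s. measure lebesgue (U \<inter> {x. x \<bullet> k < s}) = r * measure lebesgue U"
proof (cases "U = {}")
  case False
  define M where "M = distr (restrict_space lborel U) borel (\<lambda>x. x \<bullet> k)"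
  have Ub: "U \<in> sets borel" using U by simp
  have meas: "(\<lambda>x. x \<bullet> k) \<in> borel_measurable (restrict_space lborel U)"
    by (intro measurable_restrict_space1) simp
  have emM: "measure M A = measure lebesgue (U \<inter> {x. x \<bullet> k \<in> A})" if "A \<in> sets borel" for A
  proof -
    have A: "U \<inter> {x. x \<bullet> k \<in> A} \<in> sets borel"
      using measurable_sets[OF meas that] Ub
      by (auto simp: sets_restrict_space space_restrict_space vimage_def Int_commute)
    have "measure M A = measure (restrict_space lborel U) ({x. x \<bullet> k \<in> A} \<inter> U)"
      using that meas unfolding M_def by (subst measure_distr) (auto simp: space_restrict_space vimage_def)
    also have "\<dots> = measure lborel (U \<inter> {x. x \<bullet> k \<in> A})"
      using Ub by (subst measure_restrict_space) (auto simp: Int_commute)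
    also have "\<dots> = measure lebesgue (U \<inter> {x. x \<bullet> k \<in> A})"
      using A by (simp add: measure_completion)
    finally show ?thesis .
  qed
  have "finite_measure (restrict_space lborel U)"
  proof
    have "emeasure lborel U < \<infinity>" using U by (rule_tac emeasure_bounded_finite) auto
    then show "emeasure (restrict_space lborel U) (space (restrict_space lborel U)) \<noteq> \<infinity>"
      using Ub by (simp add: emeasure_restrict_space space_restrict_space)
  qed
  then interpret finite_measure M
    unfolding M_def by (rule finite_measure.finite_measure_distr) (rule meas)
  interpret finite_borel_measure M
    by unfold_locales (simp add: M_def)
  \<comment> \<open>Hyperplanes being null sets, the distribution has no atoms, which is continuity of its distribution function.\<close>
  have hyp: "negligible (U \<inter> {x. x \<bullet> k = s})" for s
    by (rule negligible_subset[OF negligible_standard_hyperplane[OF k, of s]]) auto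
  have "isCont (cdf M) s" for s
    unfolding isCont_cdf using hyp[of s] by (simp add: emM negligible_imp_measure0)
  then have cont: "continuous_on UNIV (cdf M)"
    by (simp add: continuous_at_imp_continuous_on)
  have total: "measure M (space M) = measure lebesgue U"
    using emM[of UNIV] by (simp add: borel_UNIV)
  have pos: "0 < measure lebesgue U" using U False by (intro measure_open_pos)
  have "\<forall>\<^sub>F s in at_bot. cdf M s < r * measure lebesgue U"
    using order_tendstoD(2)[OF cdf_lim_at_bot] pos r by simp
  then obtain l where l: "cdf M l < r * measure lebesgue U"
    unfolding eventually_at_bot_linorder by blast
  have "\<forall>\<^sub>F s in at_top. r * measure lebesgue U < cdf M s"
    using order_tendstoD(1)[OF cdf_lim_at_top, of "r * measure lebesgue U"] pos r total by simp
  then obtain u where u: "r * measure lebesgue U < cdf M u"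
    unfolding eventually_at_top_linorder by blast
  have "l \<le> u" using l u cdf_nondecreasing[of u l] by linarith
  then obtain s where s: "cdf M s = r * measure lebesgue U"
    using IVT'[of "cdf M" l _ u] l u cont by (metis continuous_on_subset less_imp_le subset_UNIV)
  \<comment> \<open>The distribution function counts the points on the hyperplane as well.\<close>
  have "measure lebesgue (U \<inter> {x. x \<bullet> k < s}) = cdf M s"
  proof -
    have "measure lebesgue (U \<inter> {x. x \<bullet> k < s} \<union> U \<inter> {x. x \<bullet> k = s})
        = measure lebesgue (U \<inter> {x. x \<bullet> k < s})"
      using U hyp by (intro measure_Un_null_set lmeasurable_open fmeasurableD bounded_Int open_Int
          open_halfspace_component_lt) (auto simp: negligible_iff_null_sets)
    moreover have "U \<inter> {x. x \<bullet> k < s} \<union> U \<inter> {x. x \<bullet> k = s} = U \<inter> {x. x \<bullet> k \<in> {..s}}" by auto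
    ultimately show ?thesis by (simp add: cdf_def emM)
  qed
  with s show ?thesis by auto
qed auto

section \<open>The Brunn-Minkowski inequality for disjoint unions of boxes\<close>

definition brunn_minkowski :: "'a::euclidean_space set \<Rightarrow> 'a set \<Rightarrow> bool" where
  "brunn_minkowski A B \<longleftrightarrow>
     root DIM('a) (measure lebesgue A) + root DIM('a) (measure lebesgue B)
       \<le> root DIM('a) (measure lebesgue (A + B))"

lemma brunn_minkowski_commute: "brunn_minkowski A B \<longleftrightarrow> brunn_minkowski B A"
  by (simp add: brunn_minkowski_def add.commute)

text \<open>The \<open>n\<close>-th power of the Brunn-Minkowski inequality for \<open>A'\<close> and \<open>B'\<close>, written in
  terms of the sets \<open>A\<close> and \<open>B\<close> of which they are the same fraction \<open>r\<close>: the
  inequality is homogeneous, so \<open>r\<close> factors out. In this form the bounds for two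
  complementary parts can be added.\<close>

lemma brunn_minkowski_proportional:
  fixes A B A' B' :: "'a::euclidean_space set"
  assumes "brunn_minkowski A' B'" "0 \<le> r"
    and "measure lebesgue A' = r * measure lebesgue A" "measure lebesgue B' = r * measure lebesgue B"
  shows "r * (root DIM('a) (measure lebesgue A) + root DIM('a) (measure lebesgue B)) ^ DIM('a)
           \<le> measure lebesgue (A' + B')"
proof -
  let ?n = "DIM('a)" and ?s = "root DIM('a) (measure lebesgue A) + root DIM('a) (measure lebesgue B)"
  have "root ?n r * ?s \<le> root ?n (measure lebesgue (A' + B'))"
    using assms by (simp add: brunn_minkowski_def real_root_mult distrib_left)
  then have "(root ?n r * ?s) ^ ?n \<le> root ?n (measure lebesgue (A' + B')) ^ ?n"
    using assms(2) by (intro power_mono) auto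
  then show ?thesis
    using assms(2) by (simp add: power_mult_distrib)
qed

text \<open>The sum of the two lower parts lies below the height \<open>t + s\<close> and the sum of the two upper parts above
  it. So these sums are disjoint, and their volumes, which are at least the fractions \<open>r\<close> and
  \<open>1 - r\<close> of the desired bound, add up.\<close>

lemma brunn_minkowski_glue:
  fixes A B :: "'a::euclidean_space set"
  assumes A: "open A" "bounded A" "A \<noteq> {}" and B: "open B" "bounded B" and k: "k \<in> Basis"
    and ratio: "measure lebesgue (A \<inter> {x. x \<bullet> k < t}) = r * measure lebesgue A"
      "measure lebesgue (B \<inter> {x. x \<bullet> k < s}) = r * measure lebesgue B"
    and lower: "brunn_minkowski (A \<inter> {x. x \<bullet> k < t}) (B \<inter> {x. x \<bullet> k < s})"
    and upper: "brunn_minkowski (A \<inter> {x. t < x \<bullet> k}) (B \<inter> {x. s < x \<bullet> k})"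
  shows "brunn_minkowski A B"
proof -
  let ?n = "DIM('a)" and ?s = "root DIM('a) (measure lebesgue A) + root DIM('a) (measure lebesgue B)"
  let ?A1 = "A \<inter> {x. x \<bullet> k < t}" and ?A2 = "A \<inter> {x. t < x \<bullet> k}"
  let ?B1 = "B \<inter> {x. x \<bullet> k < s}" and ?B2 = "B \<inter> {x. s < x \<bullet> k}"
  have posA: "0 < measure lebesgue A" using A by (rule measure_open_pos)
  have ratio': "measure lebesgue ?A2 = (1 - r) * measure lebesgue A"
    "measure lebesgue ?B2 = (1 - r) * measure lebesgue B"
    using measure_split_hyperplane[OF A(1,2) k, of t] measure_split_hyperplane[OF B k, of s] ratio
    by (auto simp: algebra_simps)
  have r: "0 \<le> r" "0 \<le> 1 - r"
    using ratio(1) ratio'(1) posA by (metis measure_nonneg zero_le_mult_iff not_le)+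
  have low: "r * ?s ^ ?n \<le> measure lebesgue (?A1 + ?B1)"
    using lower r(1) ratio by (rule brunn_minkowski_proportional)
  have up: "(1 - r) * ?s ^ ?n \<le> measure lebesgue (?A2 + ?B2)"
    using upper r(2) ratio' by (rule brunn_minkowski_proportional)
  have open': "open ?A1" "open ?A2"
    using A by (auto intro: open_halfspace_component_lt open_halfspace_component_gt)
  have bdd: "bounded ?A1" "bounded ?A2" "bounded ?B1" "bounded ?B2"
    using A B by auto
  have m: "?A1 + ?B1 \<in> lmeasurable" "?A2 + ?B2 \<in> lmeasurable" "A + B \<in> lmeasurable"
    using A B open' bdd by (auto intro!: lmeasurable_open open_set_plus bounded_set_plus)
  have "?A1 + ?B1 \<subseteq> {x. x \<bullet> k < t + s}" "?A2 + ?B2 \<subseteq> {x. t + s < x \<bullet> k}"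
    by (auto simp: set_plus_def inner_add_left intro: add_strict_mono)
  then have "(?A1 + ?B1) \<inter> (?A2 + ?B2) = {}"
    by force
  then have "measure lebesgue (?A1 + ?B1) + measure lebesgue (?A2 + ?B2)
      = measure lebesgue ((?A1 + ?B1) \<union> (?A2 + ?B2))"
    using m by (subst measure_Un_AE) auto
  also have "\<dots> \<le> measure lebesgue (A + B)"
    using m by (intro measure_mono_fmeasurable) (auto simp: set_plus_def)
  finally have "?s ^ ?n \<le> measure lebesgue (A + B)"
    using low up by (simp add: algebra_simps)
  then have "root ?n (?s ^ ?n) \<le> root ?n (measure lebesgue (A + B))"
    by simp
  then show ?thesis
    by (simp add: brunn_minkowski_def real_root_power_cancel)
qed

text \<open>The hyperplane for \<open>F\<close> leaves one box of \<open>F\<close> entirely on either side, so both parts of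
  \<open>F\<close> have fewer boxes. The hyperplane for \<open>G\<close> is dictated by the ratio of volumes and may cut
  any number of boxes, but it never increases the number of boxes on one side.\<close>

lemma brunn_minkowski_cut_step:
  fixes F G :: "'a::euclidean_space set set"
  assumes F: "box_family F" and G: "box_family G" and ST: "S \<in> F" "T \<in> F" "S \<noteq> T"
    and IH: "\<And>F' G'. box_family F' \<Longrightarrow> box_family G' \<Longrightarrow> card F' < card F \<Longrightarrow> card G' \<le> card G
               \<Longrightarrow> brunn_minkowski (\<Union>F') (\<Union>G' :: 'a set)"
  shows "brunn_minkowski (\<Union>F) (\<Union>G)"
proof -
  obtain k t S' T' where k: "k \<in> Basis" and ST': "S' \<in> F" "T' \<in> F"
    "S' \<subseteq> {x. x \<bullet> k < t}" "T' \<subseteq> {x. t < x \<bullet> k}"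
    using box_family_separate[OF F ST] .
  let ?A = "\<Union>F" and ?B = "\<Union>G"
  note A = box_family_Union[OF F] and B = box_family_Union[OF G]
  have fin: "finite F" "finite G" using F G by (auto simp: box_family_def)
  have neST: "S' \<noteq> {}" "T' \<noteq> {}" using F ST' by (auto simp: box_family_def)
  have neA: "?A \<inter> {x. x \<bullet> k < t} \<noteq> {}" "?A \<inter> {x. t < x \<bullet> k} \<noteq> {}"
    using ST' neST by blast+
  define r where "r = measure lebesgue (?A \<inter> {x. x \<bullet> k < t}) / measure lebesgue ?A"
  have pos: "0 < measure lebesgue ?A" "0 < measure lebesgue ?B"
    using measure_open_pos[OF A(1,2,4)] measure_open_pos[OF B(1,2,4)] by auto
  have posA: "0 < measure lebesgue (?A \<inter> {x. x \<bullet> k < t})" "0 < measure lebesgue (?A \<inter> {x. t < x \<bullet> k})"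
    using measure_open_pos[OF open_Int[OF A(1) open_halfspace_component_lt] _ neA(1)]
      measure_open_pos[OF open_Int[OF A(1) open_halfspace_component_gt] _ neA(2)] A(2) by auto
  have splitA: "measure lebesgue ?A = measure lebesgue (?A \<inter> {x. x \<bullet> k < t})
      + measure lebesgue (?A \<inter> {x. t < x \<bullet> k})"
    using A k by (intro measure_split_hyperplane)
  have r: "0 < r" "r < 1" using pos posA splitA by (auto simp: r_def)
  obtain s where s: "measure lebesgue (?B \<inter> {x. x \<bullet> k < s}) = r * measure lebesgue ?B"
    using exists_hyperplane_of_ratio[OF B(1,2) k r] by blast
  have splitB: "measure lebesgue ?B = measure lebesgue (?B \<inter> {x. x \<bullet> k < s})
      + measure lebesgue (?B \<inter> {x. s < x \<bullet> k})"
    using B k by (intro measure_split_hyperplane)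
  \<comment> \<open>Because \<open>r\<close> lies strictly between 0 and 1, both parts of \<open>\<Union>G\<close> have positive volume, hence contain boxes.\<close>
  have "0 < r * measure lebesgue ?B" "r * measure lebesgue ?B < 1 * measure lebesgue ?B"
    using r pos by simp_all
  then have "measure lebesgue (?B \<inter> {x. x \<bullet> k < s}) \<noteq> 0" "measure lebesgue (?B \<inter> {x. s < x \<bullet> k}) \<noteq> 0"
    using s splitB by linarith+
  then have neB: "?B \<inter> {x. x \<bullet> k < s} \<noteq> {}" "?B \<inter> {x. s < x \<bullet> k} \<noteq> {}"
    by (intro notI, simp only: measure_empty)+
  show ?thesis
  proof (rule brunn_minkowski_glue[OF A(1,2,4) B(1,2) k _ s])
    show "measure lebesgue (?A \<inter> {x. x \<bullet> k < t}) = r * measure lebesgue ?A"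
      using pos by (simp add: r_def)
    have "card (trace_family F {x. x \<bullet> k < t}) < card F"
      by (rule card_trace_family_less[OF fin(1) ST'(2)]) (use ST' in force)
    then show "brunn_minkowski (?A \<inter> {x. x \<bullet> k < t}) (?B \<inter> {x. x \<bullet> k < s})"
      using IH[of "trace_family F {x. x \<bullet> k < t}" "trace_family G {x. x \<bullet> k < s}"]
        box_family_trace[OF F k _ neA(1)] box_family_trace[OF G k _ neB(1)] card_trace_family_le[OF fin(2)]
      by (auto simp: Union_trace_family)
    have "card (trace_family F {x. t < x \<bullet> k}) < card F"
      by (rule card_trace_family_less[OF fin(1) ST'(1)]) (use ST' in force)
    then show "brunn_minkowski (?A \<inter> {x. t < x \<bullet> k}) (?B \<inter> {x. s < x \<bullet> k})"
      using IH[of "trace_family F {x. t < x \<bullet> k}" "trace_family G {x. s < x \<bullet> k}"]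
        box_family_trace[OF F k _ neA(2)] box_family_trace[OF G k _ neB(2)] card_trace_family_le[OF fin(2)]
      by (auto simp: Union_trace_family)
  qed
qed

text \<open>Induction on the total number of boxes. The inequality is symmetric, so the cut can start from
  whichever family has two boxes.\<close>

theorem brunn_minkowski_box_families:
  fixes F G :: "'a::euclidean_space set set"
  assumes "box_family F" "box_family G"
  shows "brunn_minkowski (\<Union>F) (\<Union>G)"
  using assms
proof (induction "card F + card G" arbitrary: F G rule: less_induct)
  case less
  consider (F) S T where "S \<in> F" "T \<in> F" "S \<noteq> T" | (G) S T where "S \<in> G" "T \<in> G" "S \<noteq> T"
    | (single) S T where "F = {S}" "G = {T}"
    using less.prems unfolding box_family_def by (metis is_singletonI' is_singleton_def)
  then show ?case
  proof cases
    case F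
    show ?thesis
      by (rule brunn_minkowski_cut_step[OF less.prems F]) (rule less.hyps; simp)
  next
    case G
    have "brunn_minkowski (\<Union>G) (\<Union>F)"
      by (rule brunn_minkowski_cut_step[OF less.prems(2,1) G])
        (subst brunn_minkowski_commute, rule less.hyps; simp)
    then show ?thesis by (simp add: brunn_minkowski_commute)
  next
    case single
    then have "S \<noteq> {} \<and> (\<exists>a b. S = box a b)" "T \<noteq> {} \<and> (\<exists>a b. T = box a b)"
      using less.prems by (simp_all add: box_family_def)
    then obtain a b c d where "S = box a b" "T = box c d" "S \<noteq> {}" "T \<noteq> {}"
      by blast
    then show ?thesis
      using brunn_minkowski_box[of a b c d] single by (simp add: brunn_minkowski_def)
  qed
qed

section \<open>From volume to lattice points\<close>

lemma finite_vec_components: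
  assumes "finite S"
  shows "finite {x :: 'a ^ 'n. \<forall>i. x $ i \<in> S}"
proof -
  have "{x :: 'a ^ 'n. \<forall>i. x $ i \<in> S} \<subseteq> vec_lambda ` (PiE UNIV (\<lambda>_. S))"
  proof
    fix x :: "'a ^ 'n" assume "x \<in> {x. \<forall>i. x $ i \<in> S}"
    then have "vec_nth x \<in> PiE UNIV (\<lambda>_. S)" by auto
    then show "x \<in> vec_lambda ` (PiE UNIV (\<lambda>_. S))"
      by (metis image_eqI vec_nth_inverse)
  qed
  then show ?thesis
    by (rule finite_subset) (simp add: assms finite_PiE)
qed

lemma finite_bounded_Int_int_lattice:
  fixes A :: "(real ^ 'n) set"
  assumes "bounded A"
  shows "finite (A \<inter> int_lattice)"
proof -
  obtain B where B: "\<forall>x\<in>A. norm x \<le> B" using assms unfolding bounded_iff by blast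
  have "A \<inter> int_lattice \<subseteq> {x. \<forall>i. x $ i \<in> {z \<in> \<int>. \<bar>z\<bar> \<le> B}}"
  proof (intro subsetI CollectI allI conjI)
    fix x i assume x: "x \<in> A \<inter> int_lattice"
    then show "x $ i \<in> \<int>" by (simp add: int_lattice_def)
    show "\<bar>x $ i\<bar> \<le> B" using x B component_le_norm_cart[of x i] by fastforce
  qed
  then show ?thesis
    using finite_vec_components[OF finite_abs_int_segment] by (rule finite_subset)
qed

lemma bounded_open_cube: "bounded (open_cube :: (real ^ 'n) set)"
proof -
  have "(open_cube :: (real ^ 'n) set) = box (- 1) 1"
    by (auto simp: open_cube_def mem_box_cart)
  then show ?thesis by (metis bounded_box)
qed

text \<open>If \<open>x = y + e\<close> with \<open>y \<in> A\<close> and \<open>e\<close> in the open unit cube, then the coordinatewise floor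
  \<open>z\<close> of \<open>x\<close> satisfies \<open>z - y = e - (x - z)\<close>, a difference of two vectors with entries in
  \<open>[0,1)\<close>, the first one with positive entries. So \<open>z\<close> lies in \<open>A + (-1,1)\<^sup>n\<close>, and \<open>U\<close> is covered by
  the unit cubes at these lattice points.\<close>

lemma measure_le_lattice_points:
  fixes A U :: "(real ^ 'n) set"
  assumes A: "bounded A" and U: "U \<in> lmeasurable" and sub: "U \<subseteq> A + box 0 1"
  shows "measure lebesgue U \<le> real (lattice_points (A + open_cube))"
proof -
  define Z where "Z = (A + open_cube) \<inter> int_lattice"
  have fin: "finite Z"
    unfolding Z_def using A by (intro finite_bounded_Int_int_lattice bounded_set_plus bounded_open_cube)
  have "U \<subseteq> (\<Union>z\<in>Z. cbox z (z + 1))"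
  proof
    fix x assume "x \<in> U"
    then obtain y e where x: "x = y + e" "y \<in> A" and e: "\<And>i. 0 < e $ i \<and> e $ i < 1"
      using sub by (auto simp: set_plus_def mem_box_cart subset_iff)
    define z where "z = (\<chi> i. real_of_int \<lfloor>x $ i\<rfloor>)"
    have zi: "z $ i \<le> x $ i" "x $ i < z $ i + 1" for i
      by (auto simp: z_def)
    have "z - y \<in> open_cube"
      unfolding open_cube_def
    proof (intro CollectI allI)
      fix i show "- 1 < (z - y) $ i \<and> (z - y) $ i < 1"
        using zi[of i] e[of i] x(1) by auto
    qed
    then have "y + (z - y) \<in> A + open_cube" using x by blast
    then have "z \<in> Z" by (simp add: Z_def int_lattice_def) (simp add: z_def)
    moreover have "x \<in> cbox z (z + 1)"
      using zi by (auto simp: mem_box_cart less_imp_le)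
    ultimately show "x \<in> (\<Union>z\<in>Z. cbox z (z + 1))" by blast
  qed
  then have "measure lebesgue U \<le> measure lebesgue (\<Union>z\<in>Z. cbox z (z + 1))"
    using U fin by (intro measure_mono_fmeasurable) (auto intro!: fmeasurable.finite_UN)
  also have "\<dots> \<le> (\<Sum>z\<in>Z. measure lebesgue (cbox z (z + 1)))"
    using fin by (intro measure_UNION_le) auto
  also have "\<dots> = (\<Sum>z\<in>Z. 1)"
  proof (intro sum.cong refl)
    fix z :: "real ^ 'n"
    have "(1 :: real ^ 'n) \<bullet> b = 1" if "b \<in> Basis" for b
      using that by (auto simp: Basis_vec_def inner_axis)
    then show "measure lebesgue (cbox z (z + 1)) = 1"
      by (subst measure_completion) (auto simp: measure_lborel_cbox_eq inner_add_left)
  qed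
  finally show ?thesis by (simp add: Z_def lattice_points_def)
qed

definition dilated_unit_cubes :: "real \<Rightarrow> (real ^ 'n) set \<Rightarrow> (real ^ 'n) set set" where
  "dilated_unit_cubes a K = (\<lambda>k. box (a *\<^sub>R k) (a *\<^sub>R k + a *\<^sub>R 1)) ` K"

lemma disjnt_dilated_unit_cubes:
  fixes k l :: "real ^ 'n"
  assumes a: "0 < a" and kl: "k \<in> int_lattice" "l \<in> int_lattice" "k \<noteq> l"
  shows "disjnt (box (a *\<^sub>R k) (a *\<^sub>R k + a *\<^sub>R 1)) (box (a *\<^sub>R l) (a *\<^sub>R l + a *\<^sub>R 1))"
proof (rule ccontr)
  assume "\<not> ?thesis"
  then obtain x where x: "x \<in> box (a *\<^sub>R k) (a *\<^sub>R k + a *\<^sub>R 1)" "x \<in> box (a *\<^sub>R l) (a *\<^sub>R l + a *\<^sub>R 1)"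
    by (auto simp: disjnt_def)
  have "k $ i = l $ i" for i
  proof -
    have "a * k $ i < a * (l $ i + 1)" "a * l $ i < a * (k $ i + 1)"
      using x by (auto simp: mem_box_cart distrib_left intro: less_trans)
    then have "k $ i < l $ i + 1" "l $ i < k $ i + 1" using a by auto
    moreover obtain m m' where "k $ i = of_int m" "l $ i = of_int m'"
      using kl by (auto simp: int_lattice_def elim!: Ints_cases) (metis Ints_cases)
    ultimately show ?thesis by simp
  qed
  then show False using kl by (simp add: vec_eq_iff)
qed

lemma
  fixes K :: "(real ^ 'n) set"
  assumes a: "0 < a" and K: "finite K" "K \<noteq> {}" "K \<subseteq> int_lattice"
  shows box_family_dilated_unit_cubes: "box_family (dilated_unit_cubes a K)"
    and measure_dilated_unit_cubes: "measure lebesgue (\<Union>(dilated_unit_cubes a K)) = a ^ CARD('n) * card K"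
proof -
  let ?c = "\<lambda>k. box (a *\<^sub>R k) (a *\<^sub>R k + a *\<^sub>R (1 :: real ^ 'n))"
  have one: "(1 :: real ^ 'n) \<bullet> b = 1" if "b \<in> Basis" for b
    using that by (auto simp: Basis_vec_def inner_axis)
  have disj: "disjnt (?c k) (?c l)" if "k \<in> K" "l \<in> K" "k \<noteq> l" for k l
    using disjnt_dilated_unit_cubes[OF a] that K by blast
  then have "disjoint (dilated_unit_cubes a K)"
    unfolding dilated_unit_cubes_def pairwise_def by force
  moreover have "?c k \<noteq> {}" for k
    using a one by (auto simp: box_ne_empty inner_add_left)
  ultimately show "box_family (dilated_unit_cubes a K)"
    using K unfolding box_family_def by (auto simp: dilated_unit_cubes_def)
  have "measure lebesgue (?c k) = a ^ CARD('n)" for k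
    using a one by (subst measure_completion) (auto simp: measure_lborel_box_eq inner_add_left)
  then have "(\<Sum>k\<in>K. measure lebesgue (?c k)) = a ^ CARD('n) * card K"
    by simp
  moreover have "measure lebesgue (\<Union>k\<in>K. ?c k) = (\<Sum>k\<in>K. measure lebesgue (?c k))"
    using K disj by (intro measure_UNION') (auto simp: pairwise_def)
  ultimately show "measure lebesgue (\<Union>(dilated_unit_cubes a K)) = a ^ CARD('n) * card K"
    by (simp add: dilated_unit_cubes_def)
qed

text \<open>Apply the Brunn-Minkowski inequality to the dilated cubes at \<open>K\<close> and \<open>L\<close>. The sum of a cube of side \<open>a\<close>
  and one of side \<open>b\<close> is a cube of side \<open>a + b\<close>, which fits into a unit cube.\<close>

lemma discrete_brunn_minkowski:
  fixes K L :: "(real ^ 'n) set"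
  assumes K: "finite K" "K \<noteq> {}" "K \<subseteq> int_lattice" and L: "finite L" "L \<noteq> {}" "L \<subseteq> int_lattice"
    and ab: "0 < a" "0 < b" "a + b \<le> 1"
  shows "a * root CARD('n) (card K) + b * root CARD('n) (card L)
    \<le> root CARD('n) (lattice_points ((*\<^sub>R) a ` K + (*\<^sub>R) b ` L + open_cube))"
proof -
  let ?A = "(*\<^sub>R) a ` K + (*\<^sub>R) b ` L" and ?U = "\<Union>(dilated_unit_cubes a K) + \<Union>(dilated_unit_cubes b L)"
  have F: "box_family (dilated_unit_cubes a K)" and G: "box_family (dilated_unit_cubes b L)"
    using box_family_dilated_unit_cubes K L ab by auto
  have "brunn_minkowski (\<Union>(dilated_unit_cubes a K)) (\<Union>(dilated_unit_cubes b L))"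
    using brunn_minkowski_box_families F G .
  then have "a * root CARD('n) (card K) + b * root CARD('n) (card L) \<le> root CARD('n) (measure lebesgue ?U)"
    using ab K L by (simp add: brunn_minkowski_def measure_dilated_unit_cubes real_root_mult real_root_power_cancel)
  also have "\<dots> \<le> root CARD('n) (lattice_points (?A + open_cube))"
  proof (intro real_root_le_mono measure_le_lattice_points)
    show "bounded ?A" using K L by (intro finite_imp_bounded finite_set_plus finite_imageI)
    show "?U \<in> lmeasurable"
      using box_family_Union[OF F] box_family_Union[OF G]
      by (auto intro!: lmeasurable_open open_set_plus bounded_set_plus)
    show "?U \<subseteq> ?A + box 0 1"
    proof
      fix u assume "u \<in> ?U"
      then obtain x y k l where u: "u = x + y" and kl: "k \<in> K" "l \<in> L"
        and x: "x \<in> box (a *\<^sub>R k) (a *\<^sub>R k + a *\<^sub>R 1)" and y: "y \<in> box (b *\<^sub>R l) (b *\<^sub>R l + b *\<^sub>R 1)"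
        by (auto simp: dilated_unit_cubes_def set_plus_def)
      let ?e = "(x - a *\<^sub>R k) + (y - b *\<^sub>R l)"
      have "0 < ?e $ i" "?e $ i < 1" for i
        using x[unfolded mem_box_cart, THEN spec[of _ i]] y[unfolded mem_box_cart, THEN spec[of _ i]] ab(3)
        by auto
      then have "?e \<in> box 0 1" by (auto simp: mem_box_cart)
      moreover have "a *\<^sub>R k + b *\<^sub>R l \<in> ?A" using kl by blast
      ultimately have "(a *\<^sub>R k + b *\<^sub>R l) + ?e \<in> ?A + box 0 1" by (rule set_plus_intro[rotated])
      then show "u \<in> ?A + box 0 1" by (simp add: u)
    qed
  qed simp
  finally show ?thesis .
qed

section \<open>Optimizing the coefficients of the p-sum\<close>

text \<open>Away from \<open>t = 0\<close> the convention for \<open>p = 1\<close> agrees with the general formula, because \<open>1/q = 1 - 1/p\<close>.\<close>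

lemma p_coeff_pos_eq:
  assumes "p \<ge> 1" "t > 0"
  shows "p_coeff p t = t powr (1 - 1 / p)"
proof (cases "p = 1")
  case False
  then have "1 / hoelder_conj p = 1 - 1 / p"
    using assms by (simp add: hoelder_conj_def field_simps)
  then show ?thesis using False by (simp add: p_coeff_def)
qed (use assms in \<open>simp add: p_coeff_def\<close>)

lemma p_coeff_bounds:
  assumes "p \<ge> 1" "0 \<le> t" "t \<le> 1"
  shows "0 \<le> p_coeff p t" "p_coeff p t \<le> 1"
  using assms by (auto simp: p_coeff_def hoelder_conj_def intro!: powr_le1)

text \<open>The equality case of Hoelder's inequality: \<open>1 - \<mu>\<close> and \<open>\<mu>\<close> have to be proportional to the summands
  \<open>(1 - \<lambda>) u\<^sup>p\<close> and \<open>\<lambda> v\<^sup>p\<close>. With \<open>S\<close> for their sum, both terms on the left become the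
  respective summand divided by \<open>S\<^sup>1\<^sup>/\<^sup>q\<close>, so the left-hand side is \<open>(S / S\<^sup>1\<^sup>/\<^sup>q)\<^sup>p = S\<close>.\<close>

lemma optimal_p_coefficients:
  fixes lam p u v :: real
  assumes lam: "0 < lam" "lam < 1" and p: "p \<ge> 1" and uv: "0 < u" "0 < v"
  obtains \<mu> where "0 < \<mu>" "\<mu> < 1"
    "(p_coeff p (1 - \<mu>) * (1 - lam) powr (1 / p) * u + p_coeff p \<mu> * lam powr (1 / p) * v) powr p
       = (1 - lam) * u powr p + lam * v powr p"
proof -
  define A B S where "A = (1 - lam) * u powr p" and "B = lam * v powr p" and "S = A + B"
  have AB: "0 < A" "0 < B" using lam uv by (auto simp: A_def B_def)
  then have pos: "0 < A" "0 < B" "0 < S" by (auto simp: S_def)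
  define \<mu> where "\<mu> = B / S"
  have \<mu>: "0 < \<mu>" "\<mu> < 1" "1 - \<mu> = A / S"
    using pos by (auto simp: \<mu>_def S_def field_simps)
  have part: "(C / S) powr (1 - 1 / p) * C powr (1 / p) = C / S powr (1 - 1 / p)" if "C > 0" for C
  proof -
    have "C powr (1 - 1 / p) * C powr (1 / p) = C"
      using that by (simp flip: powr_add)
    then show ?thesis using that pos by (simp add: powr_divide)
  qed
  have "p_coeff p (1 - \<mu>) * (1 - lam) powr (1 / p) * u = (A / S) powr (1 - 1 / p) * A powr (1 / p)"
    using lam uv p pos \<mu> by (simp add: p_coeff_pos_eq A_def powr_mult powr_powr)
  moreover have "p_coeff p \<mu> * lam powr (1 / p) * v = (B / S) powr (1 - 1 / p) * B powr (1 / p)"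
    using lam uv p pos \<mu>(1,2) by (simp add: p_coeff_pos_eq \<mu>_def) (simp add: B_def powr_mult powr_powr)
  ultimately have "p_coeff p (1 - \<mu>) * (1 - lam) powr (1 / p) * u + p_coeff p \<mu> * lam powr (1 / p) * v
      = S / S powr (1 - 1 / p)"
    using part pos by (simp add: S_def add_divide_distrib)
  also have "\<dots> = S powr (1 / p)"
    using pos by (simp add: powr_diff)
  finally show thesis
    using that[of \<mu>] \<mu> pos p by (simp add: powr_powr S_def A_def B_def)
qed

text \<open>Young's inequality bounds each product by the convex combination of its two bases with weights \<open>1/q\<close>
  and \<open>1/p\<close>.\<close>

lemma sum_p_coefficients_le_1:
  fixes lam p \<mu> :: real
  assumes "0 < lam" "lam < 1" "p \<ge> 1" "0 < \<mu>" "\<mu> < 1"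
  shows "p_coeff p (1 - \<mu>) * (1 - lam) powr (1 / p) + p_coeff p \<mu> * lam powr (1 / p) \<le> 1"
proof -
  have "(1 - \<mu>) powr (1 - 1 / p) * (1 - lam) powr (1 / p) \<le> (1 - 1 / p) * (1 - \<mu>) + 1 / p * (1 - lam)"
    "\<mu> powr (1 - 1 / p) * lam powr (1 / p) \<le> (1 - 1 / p) * \<mu> + 1 / p * lam"
    using assms by (intro Youngs_inequality_0; simp)+
  moreover have "(1 - 1 / p) * (1 - \<mu>) + 1 / p * (1 - lam) + ((1 - 1 / p) * \<mu> + 1 / p * lam) = 1"
    using assms by (simp add: field_simps)
  ultimately show ?thesis
    using assms by (simp add: p_coeff_pos_eq)
qed

text \<open>Needed because \<open>card\<close> is monotone only below a finite set: the \<open>p\<close>-sum must contain finitely many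
  lattice points for the one linear combination inside it to give a lower bound.\<close>

lemma bounded_p_sum:
  fixes A B :: "(real ^ 'n) set"
  assumes p: "p \<ge> 1" and "bounded A" "bounded B"
  shows "bounded (p_sum p A B)"
proof -
  obtain R R' where R: "\<And>x. x \<in> A \<Longrightarrow> norm x \<le> R" "\<And>x. x \<in> B \<Longrightarrow> norm x \<le> R'"
    using assms by (auto simp: bounded_iff)
  have scale: "norm (p_coeff p t *\<^sub>R x) \<le> norm x" if "0 \<le> t" "t \<le> 1" for t and x :: "real ^ 'n"
    using p_coeff_bounds[OF p that] by (simp add: mult_left_le_one_le)
  have "norm z \<le> R + R'" if zAB: "z \<in> p_sum p A B" for z
  proof -
    obtain x y \<mu> where z: "z = p_coeff p (1 - \<mu>) *\<^sub>R x + p_coeff p \<mu> *\<^sub>R y" "x \<in> A" "y \<in> B"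
      "0 \<le> \<mu>" "\<mu> \<le> 1" using zAB unfolding p_sum_def by blast
    have "norm z \<le> norm (p_coeff p (1 - \<mu>) *\<^sub>R x) + norm (p_coeff p \<mu> *\<^sub>R y)"
      unfolding z by (rule norm_triangle_ineq)
    also have "\<dots> \<le> R + R'"
      using scale[of "1 - \<mu>" x] scale[of \<mu> y] R z by fastforce
    finally show ?thesis .
  qed
  then show ?thesis by (auto simp: bounded_iff)
qed

lemma lattice_points_p_sum_ge:
  fixes K L :: "(real ^ 'n) set" and lam p :: real
  assumes lam: "0 < lam" "lam < 1" and p: "p \<ge> 1" and bdd: "bounded K" "bounded L"
    and pos: "lattice_points K * lattice_points L > 0"
  shows "(1 - lam) * real (lattice_points K) powr (p / real CARD('n))
           + lam * real (lattice_points L) powr (p / real CARD('n))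
         \<le> real (lattice_points (p_sum p (p_scale p (1 - lam) K) (p_scale p lam L) + open_cube))
            powr (p / real CARD('n))"
proof -
  let ?n = "CARD('n)" and ?P = "p_sum p (p_scale p (1 - lam) K) (p_scale p lam L)"
  define K' L' where "K' = K \<inter> int_lattice" and "L' = L \<inter> int_lattice"
  have fin: "finite K'" "finite L'"
    using bdd by (simp_all add: K'_def L'_def finite_bounded_Int_int_lattice)
  have card: "lattice_points K = card K'" "lattice_points L = card L'"
    by (simp_all add: K'_def L'_def lattice_points_def)
  have ne: "K' \<noteq> {}" "L' \<noteq> {}" using pos card by auto
  have cpos: "0 < card K'" "0 < card L'" using ne fin by auto
  have root_p: "root ?n (real m) powr p = real m powr (p / real ?n)" if "0 < m" for m
    using that by (simp add: root_powr_inverse powr_powr)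
  obtain \<mu> where \<mu>: "0 < \<mu>" "\<mu> < 1" and opt:
    "(p_coeff p (1 - \<mu>) * (1 - lam) powr (1 / p) * root ?n (card K')
        + p_coeff p \<mu> * lam powr (1 / p) * root ?n (card L')) powr p
      = (1 - lam) * root ?n (card K') powr p + lam * root ?n (card L') powr p"
    using optimal_p_coefficients[OF lam p, of "root ?n (card K')" "root ?n (card L')"] cpos by auto
  define a b where "a = p_coeff p (1 - \<mu>) * (1 - lam) powr (1 / p)"
    and "b = p_coeff p \<mu> * lam powr (1 / p)"
  have ab: "0 < a" "0 < b" "a + b \<le> 1"
    using sum_p_coefficients_le_1[OF lam p \<mu>] lam \<mu> p by (auto simp: a_def b_def p_coeff_pos_eq)
  let ?A = "(*\<^sub>R) a ` K' + (*\<^sub>R) b ` L'"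
  have "?A \<subseteq> ?P"
  proof
    fix z assume "z \<in> ?A"
    then obtain x y where z: "z = a *\<^sub>R x + b *\<^sub>R y" "x \<in> K" "y \<in> L"
      by (auto simp: set_plus_def K'_def L'_def)
    have "z = p_coeff p (1 - \<mu>) *\<^sub>R ((1 - lam) powr (1 / p) *\<^sub>R x) + p_coeff p \<mu> *\<^sub>R (lam powr (1 / p) *\<^sub>R y)"
      by (simp add: z a_def b_def)
    then show "z \<in> ?P"
      unfolding p_sum_def p_scale_def using z \<mu> less_imp_le by blast
  qed
  then have sub: "(?A + open_cube) \<inter> int_lattice \<subseteq> (?P + open_cube) \<inter> int_lattice"
    by (auto simp: set_plus_def)
  have "bounded ?P"
    using bdd p by (intro bounded_p_sum) (auto simp: p_scale_def intro!: bounded_scaling)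
  then have "finite ((?P + open_cube) \<inter> int_lattice)"
    by (intro finite_bounded_Int_int_lattice bounded_set_plus bounded_open_cube)
  then have le: "lattice_points (?A + open_cube) \<le> lattice_points (?P + open_cube)"
    unfolding lattice_points_def using sub by (rule card_mono)
  have "(1 - lam) * real (card K') powr (p / ?n) + lam * real (card L') powr (p / ?n)
      = (a * root ?n (card K') + b * root ?n (card L')) powr p"
    using opt cpos by (simp add: a_def b_def root_p)
  also have "\<dots> \<le> root ?n (lattice_points (?P + open_cube)) powr p"
  proof (rule powr_mono2)
    have "a * root ?n (card K') + b * root ?n (card L') \<le> root ?n (lattice_points (?A + open_cube))"
      using discrete_brunn_minkowski[OF fin(1) ne(1) _ fin(2) ne(2) _ ab] by (simp add: K'_def L'_def)
    also have "\<dots> \<le> root ?n (lattice_points (?P + open_cube))"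
      using le by simp
    finally show "a * root ?n (card K') + b * root ?n (card L') \<le> root ?n (lattice_points (?P + open_cube))" .
  qed (use p ab in auto)
  also have "\<dots> = real (lattice_points (?P + open_cube)) powr (p / ?n)"
    by (cases "lattice_points (?P + open_cube) = 0") (auto simp: root_p)
  finally show ?thesis by (simp add: card)
qed

lemma lattice_points_p_sum_origin:
  "lattice_points (p_sum p (p_scale p s {0}) (p_scale p t {0}) + open_cube :: (real ^ 'n) set) = 1"
proof -
  have "p_sum p (p_scale p s {0}) (p_scale p t {0}) = {0 :: real ^ 'n}"
    by (auto simp: p_sum_def p_scale_def intro: exI[of _ 0])
  moreover have "{0 :: real ^ 'n} + open_cube = open_cube"
    by (auto simp: set_plus_def)
  moreover have "open_cube \<inter> int_lattice = {0 :: real ^ 'n}"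
  proof -
    have "z = 0" if "-1 < z" "z < 1" "z \<in> \<int>" for z :: real
      using that by (auto elim!: Ints_cases)
    then show ?thesis by (auto simp: open_cube_def int_lattice_def vec_eq_iff)
  qed
  ultimately show ?thesis by (simp add: lattice_points_def)
qed

theorem theorem1p1:
  fixes lam p :: real
  assumes "0 < lam" and "lam < 1" and "p \<ge> 1"
  shows
    "(\<forall>K L :: (real ^ 'n) set.
        bounded K \<longrightarrow> bounded L \<longrightarrow> lattice_points K * lattice_points L > 0 \<longrightarrow>
        real (lattice_points (p_sum p (p_scale p (1 - lam) K) (p_scale p lam L) + open_cube))
            powr (p / real CARD('n))
          \<ge> (1 - lam) * real (lattice_points K) powr (p / real CARD('n))
             + lam * real (lattice_points L) powr (p / real CARD('n)))
     \<and>
     (\<exists>K L :: (real ^ 'n) set.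
        bounded K \<and> bounded L \<and> lattice_points K * lattice_points L > 0 \<and>
        real (lattice_points (p_sum p (p_scale p (1 - lam) K) (p_scale p lam L) + open_cube))
            powr (p / real CARD('n))
          = (1 - lam) * real (lattice_points K) powr (p / real CARD('n))
             + lam * real (lattice_points L) powr (p / real CARD('n)))"
proof (intro conjI allI impI)
  have origin: "lattice_points {0 :: real ^ 'n} = 1"
    by (simp add: lattice_points_def int_lattice_def)
  show "\<exists>K L :: (real ^ 'n) set.
        bounded K \<and> bounded L \<and> lattice_points K * lattice_points L > 0 \<and>
        real (lattice_points (p_sum p (p_scale p (1 - lam) K) (p_scale p lam L) + open_cube))
            powr (p / real CARD('n))
          = (1 - lam) * real (lattice_points K) powr (p / real CARD('n))
             + lam * real (lattice_points L) powr (p / real CARD('n))"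
    by (intro exI[of _ "{0}"]) (use assms in \<open>simp add: origin lattice_points_p_sum_origin\<close>)
qed (use lattice_points_p_sum_ge assms in blast)

end
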